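(* Let $(\mathcal G,\cdot,\Delta,\mathcal R)$ be a quasitriangular (unital, associative) 2-bialgebra, i.e. a 2-bialgebra with an invertible quasitriangular 2-$R$-matrix $\mathcal R=\mathcal R^l+\mathcal R^r$. Then $\mathcal R$ satisfies the 2-Yang–Baxter equations $$\mathcal R^r_{23}(\mathcal R^r_{13}\cdot_l\mathcal R^l_{12})=(\mathcal R^l_{12}\cdot_r\mathcal R^r_{13})\mathcal R^r_{23},\qquad(\mathcal R^l_{23}\cdot_l\mathcal R^r_{13})\mathcal R^r_{12}=\mathcal R^r_{12}(\mathcal R^r_{13}\cdot_r\mathcal R^l_{23}),$$ $$\mathcal R^l_{23}(\mathcal R^l_{13}\cdot_r\mathcal R^r_{12})=(\mathcal R^r_{12}\cdot_l\mathcal R^l_{13})\mathcal R^l_{23},\qquad(\mathcal R^r_{23}\cdot_r\mathcal R^l_{13})\mathcal R^l_{12}=\mathcal R^l_{12}(\mathcal R^l_{13}\cdot_l\mathcal R^r_{23}).$$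
   Context: Everything is finite dimensional over a field $k$; $x,x'\in\mathcal G_0$, $y,y'\in\mathcal G_{-1}$. **Associative 2-algebra** $\mathcal G$: associative algebras $\mathcal G_0,\mathcal G_{-1}$, an algebra homomorphism $t:\mathcal G_{-1}\to\mathcal G_0$ and bilinear actions $x\cdot_ly=x\cdot y$, $y\cdot_rx=y\cdot x$ in $\mathcal G_{-1}$ with $(x'x)\cdot y=x'\cdot(x\cdot y)$, $(x\cdot y)\cdot x'=x\cdot(y\cdot x')$, $y\cdot(xx')=(y\cdot x)\cdot x'$; $t(x\cdot y)=x\,t(y)$, $t(y\cdot x)=t(y)x$; $t(y)\cdot y'=yy'=y\cdot t(y')$. Unital: units $\eta_{-1},\eta_0$ with $t\eta_{-1}=\eta_0$, $\eta_0$ acting as the identity. **Coassociative 2-coalgebra**: maps $\Delta_{-1}:\mathcal G_{-1}\to\mathcal G_{-1}^{\otimes2}$, $\Delta_0=\Delta_0^l+\Delta_0^r$, $\Delta_0^l:\mathcal G_0\to\mathcal G_{-1}\otimes\mathcal G_0$, $\Delta_0^r:\mathcal G_0\to\mathcal G_0\otimes\mathcal G_{-1}$, $\Delta_0':\mathcal G_0\to\mathcal G_0^{\otimes2}$, with $\Delta_{-1},\Delta_0'$ coassociative; $(\Delta_{-1}\otimes\mathrm{id})\Delta_0^l=(\mathrm{id}\otimes\Delta_0^l)\Delta_0^l$, $(\mathrm{id}\otimes\Delta_{-1})\Delta_0^r=(\Delta_0^r\otimes\mathrm{id})\Delta_0^r$, $(\mathrm{id}\otimes\Delta_0^r)\Delta_0^l=(\Delta_0^l\otimes\mathrm{id})\Delta_0^r$;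 $t$ a coalgebra map with $(t\otimes1+1\otimes t)\Delta_{-1}=\Delta_0t$, $(t\otimes\mathrm{id})\Delta_0^l=\Delta_0'=(\mathrm{id}\otimes t)\Delta_0^r$. **2-bialgebra**: both, with (Sweedler: $\Delta_{-1}(y)=y_{(1)}\otimes y_{(2)}$, $\Delta_0^{l,r}(x)=x^{l,r}_{(1)}\otimes x^{l,r}_{(2)}$, $\Delta_0'(x)=\bar x_{(1)}\otimes\bar x_{(2)}$) $\Delta_{-1}(x\cdot y)=\bar x_{(1)}\cdot y_{(1)}\otimes\bar x_{(2)}\cdot y_{(2)}$, $\Delta_{-1}(y\cdot x)=y_{(1)}\cdot\bar x_{(1)}\otimes y_{(2)}\cdot\bar x_{(2)}$, $\Delta_0^l(xx')=x_{(1)}^lx'^l_{(1)}\otimes x^l_{(2)}x'^l_{(2)}$, $\Delta_0^r(xx')=x_{(1)}^rx'^r_{(1)}\otimes x^r_{(2)}x'^r_{(2)}$. **Quasitriangular 2-$R$-matrix**: elements $\mathcal R^l\in\mathcal G_{-1}\otimes\mathcal G_0$, $\mathcal R^r\in\mathcal G_0\otimes\mathcal G_{-1}$ with 1. $(\Delta_0^l\otimes\mathrm{id})\mathcal R^r=\mathcal R^l_{13}\cdot_l\mathcal R^r_{23}$, $(\Delta_0^r\otimes\mathrm{id})\mathcal R^r=\mathcal R^r_{13}\cdot_r\mathcal R^l_{23}$, $(\mathrm{id}\otimes\Delta_0^l)\mathcal R^l=\mathcal R^l_{13}\cdot_r\mathcal R^r_{12}$, $(\mathrm{id}\otimes\Delta_0^r)\mathcal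 R^l=\mathcal R^r_{13}\cdot_l\mathcal R^l_{12}$; 2. $\mathcal R^r\Delta_0^r(x)=\sigma(\Delta_0^l(x))\mathcal R^r$, $\mathcal R^l\Delta_0^l(x)=\sigma(\Delta_0^r(x))\mathcal R^l$ for all $x\in\mathcal G_0$, $\sigma$ the permutation of tensor factors; 3. $(t\otimes\mathrm{id})\mathcal R^l=(\mathrm{id}\otimes t)\mathcal R^r\in\mathcal G_0^{\otimes2}$. Here subscripts indicate the tensor legs of $\mathcal G^{\otimes3}$, products are taken leg by leg, and $\cdot_l$ (resp. $\cdot_r$) indicates that on the common leg the left (resp. right) action of the $\mathcal G_0$-factor on the $\mathcal G_{-1}$-factor is used. $\mathcal R$ is invertible iff $\mathcal R^l$ and $\mathcal R^r$ are both invertible (in $\mathcal G_{-1}\otimes\mathcal G_0$, $\mathcal G_0\otimes\mathcal G_{-1}$). *)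

theory Defs
  imports Complex_Main "HOL-Library.Function_Algebras"
begin

section \<open>Tensor products of vector spaces\<close>

text \<open>
  A vector space over the field \<open>'k\<close> is a type together with a scalar multiplication \<open>s\<close>
  satisfying \<open>vector_space s\<close>.  As a type cannot depend on \<open>s\<close>, the tensor product is
  realised inside a function type: \<open>a \<otimes> b\<close> is the evaluation \<open>\<beta> \<mapsto> \<beta> a b\<close> of bilinear forms,
  and \<open>V \<otimes> W\<close> is the span of these evaluations in the dual of the space of bilinear forms on
  \<open>V \<times> W\<close> (for finite-dimensional \<open>V\<close>, \<open>W\<close> it is the whole dual).  The functionals are defined
  to be zero on functions that are not bilinear forms, so that equality of tensors is equality
  of functions.  The lemmas \<open>bilinear_map_tensor2\<close> and \<open>tensor2_universal\<close> say that this is the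
  tensor product: every bilinear map factors uniquely through \<open>\<otimes>\<close>.  Threefold tensor products
  are treated in the same way with trilinear forms.
\<close>

type_synonym ('k, 'a, 'b) tensor2 = "('a \<Rightarrow> 'b \<Rightarrow> 'k) \<Rightarrow> 'k"
type_synonym ('k, 'a, 'b, 'c) tensor3 = "('a \<Rightarrow> 'b \<Rightarrow> 'c \<Rightarrow> 'k) \<Rightarrow> 'k"

definition bilinear_map ::
  "('k::field \<Rightarrow> 'a::ab_group_add \<Rightarrow> 'a) \<Rightarrow> ('k \<Rightarrow> 'b::ab_group_add \<Rightarrow> 'b)
    \<Rightarrow> ('k \<Rightarrow> 'c::ab_group_add \<Rightarrow> 'c) \<Rightarrow> ('a \<Rightarrow> 'b \<Rightarrow> 'c) \<Rightarrow> bool" where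
  "bilinear_map sA sB sC F \<longleftrightarrow>
    (\<forall>b. Vector_Spaces.linear sA sC (\<lambda>a. F a b)) \<and> (\<forall>a. Vector_Spaces.linear sB sC (\<lambda>b. F a b))"

definition trilinear_map ::
  "('k::field \<Rightarrow> 'a::ab_group_add \<Rightarrow> 'a) \<Rightarrow> ('k \<Rightarrow> 'b::ab_group_add \<Rightarrow> 'b)
    \<Rightarrow> ('k \<Rightarrow> 'c::ab_group_add \<Rightarrow> 'c) \<Rightarrow> ('k \<Rightarrow> 'd::ab_group_add \<Rightarrow> 'd)
    \<Rightarrow> ('a \<Rightarrow> 'b \<Rightarrow> 'c \<Rightarrow> 'd) \<Rightarrow> bool" where
  "trilinear_map sA sB sC sD F \<longleftrightarrow>
    (\<forall>b c. Vector_Spaces.linear sA sD (\<lambda>a. F a b c)) \<and>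
    (\<forall>a c. Vector_Spaces.linear sB sD (\<lambda>b. F a b c)) \<and>
    (\<forall>a b. Vector_Spaces.linear sC sD (\<lambda>c. F a b c))"

definition tensor2 ::
  "('k::field \<Rightarrow> 'a::ab_group_add \<Rightarrow> 'a) \<Rightarrow> ('k \<Rightarrow> 'b::ab_group_add \<Rightarrow> 'b)
    \<Rightarrow> 'a \<Rightarrow> 'b \<Rightarrow> ('k, 'a, 'b) tensor2" where
  "tensor2 sA sB a b = (\<lambda>\<beta>. if bilinear_map sA sB (*) \<beta> then \<beta> a b else 0)"

definition tensor3 ::
  "('k::field \<Rightarrow> 'a::ab_group_add \<Rightarrow> 'a) \<Rightarrow> ('k \<Rightarrow> 'b::ab_group_add \<Rightarrow> 'b)
    \<Rightarrow> ('k \<Rightarrow> 'c::ab_group_add \<Rightarrow> 'c) \<Rightarrow> 'a \<Rightarrow> 'b \<Rightarrow> 'c \<Rightarrow> ('k, 'a, 'b, 'c) tensor3" where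
  "tensor3 sA sB sC a b c = (\<lambda>\<beta>. if trilinear_map sA sB sC (*) \<beta> then \<beta> a b c else 0)"

definition fun_scale :: "'k::field \<Rightarrow> ('x \<Rightarrow> 'k) \<Rightarrow> 'x \<Rightarrow> 'k" where
  "fun_scale c f = (\<lambda>x. c * f x)"

definition tensor_space2 ::
  "('k::field \<Rightarrow> 'a::ab_group_add \<Rightarrow> 'a) \<Rightarrow> ('k \<Rightarrow> 'b::ab_group_add \<Rightarrow> 'b)
    \<Rightarrow> ('k, 'a, 'b) tensor2 set" where
  "tensor_space2 sA sB = module.span fun_scale {tensor2 sA sB a b | a b. True}"

text \<open>
  Linear extension along \<open>\<otimes>\<close> of a bilinear map \<open>F\<close> with values in \<open>'x \<Rightarrow> 'k\<close> (in practice in a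
  tensor product): \<open>lift2 F (\<Sum>i. a i \<otimes> b i) = (\<Sum>i. F (a i) (b i))\<close>; see \<open>lift2_sum_tensor2\<close>.
\<close>

definition lift2 :: "('a \<Rightarrow> 'b \<Rightarrow> 'x \<Rightarrow> 'k) \<Rightarrow> ('k, 'a, 'b) tensor2 \<Rightarrow> 'x \<Rightarrow> 'k" where
  "lift2 F r = (\<lambda>x. r (\<lambda>a b. F a b x))"

definition lift3 :: "('a \<Rightarrow> 'b \<Rightarrow> 'c \<Rightarrow> 'x \<Rightarrow> 'k) \<Rightarrow> ('k, 'a, 'b, 'c) tensor3 \<Rightarrow> 'x \<Rightarrow> 'k" where
  "lift3 F r = (\<lambda>x. r (\<lambda>a b c. F a b c x))"

subsection \<open>Operations on tensors\<close>

text \<open>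
  In all operations below the scalar multiplications passed as arguments are those of the
  factors of the resulting tensor product.
\<close>

text \<open>\<open>f \<otimes> g\<close>, and \<open>D \<otimes> id\<close>, \<open>id \<otimes> D\<close> for \<open>D\<close> with values in a twofold tensor product.\<close>

definition map2 where
  "map2 sA sB f g = lift2 (\<lambda>a b. tensor2 sA sB (f a) (g b))"

definition split_left where
  "split_left sA sB sC D = lift2 (\<lambda>x c. lift2 (\<lambda>a b. tensor3 sA sB sC a b c) (D x))"

definition split_right where
  "split_right sA sB sC D = lift2 (\<lambda>a x. lift2 (\<lambda>b c. tensor3 sA sB sC a b c) (D x))"

definition swap2 where
  "swap2 sA sB = lift2 (\<lambda>b a. tensor2 sA sB a b)"

text \<open>
  Leg-by-leg products: \<open>f\<close>, \<open>g\<close>, \<open>h\<close> are the bilinear products used on the first, second, third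
  leg.
\<close>

definition mul2 where
  "mul2 sA sB f g r r' =
    lift2 (\<lambda>a b. lift2 (\<lambda>a' b'. tensor2 sA sB (f a a') (g b b')) r') r"

definition mul3 where
  "mul3 sA sB sC f g h r r' =
    lift3 (\<lambda>a b c. lift3 (\<lambda>a' b' c'. tensor3 sA sB sC (f a a') (g b b') (h c c')) r') r"

text \<open>The embeddings \<open>r \<mapsto> r\<^sub>1\<^sub>2, r\<^sub>1\<^sub>3, r\<^sub>2\<^sub>3\<close> with the unit \<open>u\<close> on the idle leg.\<close>

definition leg12 where
  "leg12 sA sB sC u = lift2 (\<lambda>a b. tensor3 sA sB sC a b u)"

definition leg13 where
  "leg13 sA sB sC u = lift2 (\<lambda>a c. tensor3 sA sB sC a u c)"

definition leg23 where
  "leg23 sA sB sC u = lift2 (\<lambda>b c. tensor3 sA sB sC u b c)"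

subsection \<open>The universal property\<close>

lemma vector_space_fun_scale: "vector_space (fun_scale :: 'k::field \<Rightarrow> ('x \<Rightarrow> 'k) \<Rightarrow> _)"
  by unfold_locales (auto simp: fun_scale_def fun_eq_iff algebra_simps)

lemma linear_fun_scaleI:
  assumes "vector_space s" and "\<And>x. Vector_Spaces.linear s (*) (\<lambda>a. f a x)"
  shows "Vector_Spaces.linear s fun_scale f"
proof -
  have "f (a + b) = f a + f b" "f (s c a) = fun_scale c (f a)" for a b c
    using Vector_Spaces.linear.axioms(3)[OF assms(2)]
    by (auto simp: fun_eq_iff fun_scale_def module_hom_iff)
  then show ?thesis
    using assms(1) vector_space_fun_scale
    by (simp add: Vector_Spaces.linear_def module_hom_iff vector_space_def module_def)
qed

lemma linear_zero_form:
  "vector_space s \<Longrightarrow> Vector_Spaces.linear s ((*) :: 'k::field \<Rightarrow> _) (\<lambda>_. 0)"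
  by (simp add: Vector_Spaces.linear_def module_hom_iff vector_space_def module_def
      algebra_simps)

lemma bilinear_map_tensor2:
  assumes "vector_space sA" "vector_space sB"
  shows "bilinear_map sA sB fun_scale (tensor2 sA sB)"
  unfolding bilinear_map_def
proof (intro conjI allI)
  fix b show "Vector_Spaces.linear sA fun_scale (\<lambda>a. tensor2 sA sB a b)"
    using linear_zero_form[OF assms(1)]
    by (intro linear_fun_scaleI[OF assms(1)], rename_tac \<beta>,
        case_tac "bilinear_map sA sB (*) \<beta>")
      (simp_all add: tensor2_def, simp add: bilinear_map_def)
next
  fix a show "Vector_Spaces.linear sB fun_scale (\<lambda>b. tensor2 sA sB a b)"
    using linear_zero_form[OF assms(2)]
    by (intro linear_fun_scaleI[OF assms(2)], rename_tac \<beta>,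
        case_tac "bilinear_map sA sB (*) \<beta>")
      (simp_all add: tensor2_def, simp add: bilinear_map_def)
qed

lemma trilinear_map_tensor3:
  assumes "vector_space sA" "vector_space sB" "vector_space sC"
  shows "trilinear_map sA sB sC fun_scale (tensor3 sA sB sC)"
  unfolding trilinear_map_def
proof (intro conjI allI)
  fix b c show "Vector_Spaces.linear sA fun_scale (\<lambda>a. tensor3 sA sB sC a b c)"
    using linear_zero_form[OF assms(1)]
    by (intro linear_fun_scaleI[OF assms(1)], rename_tac \<beta>,
        case_tac "trilinear_map sA sB sC (*) \<beta>")
      (simp_all add: tensor3_def, simp add: trilinear_map_def)
next
  fix a c show "Vector_Spaces.linear sB fun_scale (\<lambda>b. tensor3 sA sB sC a b c)"
    using linear_zero_form[OF assms(2)]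
    by (intro linear_fun_scaleI[OF assms(2)], rename_tac \<beta>,
        case_tac "trilinear_map sA sB sC (*) \<beta>")
      (simp_all add: tensor3_def, simp add: trilinear_map_def)
next
  fix a b show "Vector_Spaces.linear sC fun_scale (\<lambda>c. tensor3 sA sB sC a b c)"
    using linear_zero_form[OF assms(3)]
    by (intro linear_fun_scaleI[OF assms(3)], rename_tac \<beta>,
        case_tac "trilinear_map sA sB sC (*) \<beta>")
      (simp_all add: tensor3_def, simp add: trilinear_map_def)
qed

lemma sum_fun_apply: "(\<Sum>i\<in>I. f i) x = (\<Sum>i\<in>I. f i x :: 'k::field)"
  by (induction I rule: infinite_finite_induct) auto

lemma linear_sum_apply:
  assumes "Vector_Spaces.linear s s' \<phi>"
  shows "\<phi> (\<Sum>i\<in>I. f i) = (\<Sum>i\<in>I. \<phi> (f i))"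
proof -
  interpret Vector_Spaces.linear s s' \<phi> by fact
  show ?thesis by (rule sum)
qed

lemma linear_compose_form:
  "Vector_Spaces.linear s s' f \<Longrightarrow> Vector_Spaces.linear s' s'' g
    \<Longrightarrow> Vector_Spaces.linear s s'' (\<lambda>x. g (f x))"
  using Vector_Spaces.linear_compose[of s s' f s'' g] by (simp add: o_def)

lemma forms_separate:
  assumes "vector_space (s :: 'k::field \<Rightarrow> 'a::ab_group_add \<Rightarrow> 'a)" "u \<noteq> 0"
  obtains \<phi> where "Vector_Spaces.linear s (*) \<phi>" "\<phi> u = 1"
proof -
  interpret U: vector_space s by fact
  interpret K: vector_space "(*) :: 'k \<Rightarrow> _" by unfold_locales (auto simp: algebra_simps)
  interpret UK: vector_space_pair s "(*) :: 'k \<Rightarrow> _" by unfold_locales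
  have "U.independent {u}" using assms(2) by (simp add: U.dependent_single)
  from UK.linear_independent_extend[OF this, of "\<lambda>_. 1"] that show ?thesis by auto
qed

theorem tensor2_universal:
  assumes "bilinear_map sA sB sU F" and "(\<Sum>i\<in>I. tensor2 sA sB (a i) (b i)) = 0"
  shows "(\<Sum>i\<in>I. F (a i) (b i)) = 0"
proof (rule ccontr)
  assume nz: "\<not> ?thesis"
  have "vector_space sU"
    using assms(1) by (auto simp: bilinear_map_def Vector_Spaces.linear_def)
  from forms_separate[OF this nz] obtain \<phi>
    where \<phi>: "Vector_Spaces.linear sU (*) \<phi>" "\<phi> (\<Sum>i\<in>I. F (a i) (b i)) = 1" .
  have "bilinear_map sA sB (*) (\<lambda>a b. \<phi> (F a b))"
    using assms(1) \<phi>(1) by (auto simp: bilinear_map_def intro!: linear_compose_form[OF _ \<phi>(1)])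
  then have "(\<Sum>i\<in>I. \<phi> (F (a i) (b i))) = (\<Sum>i\<in>I. tensor2 sA sB (a i) (b i)) (\<lambda>a b. \<phi> (F a b))"
    by (simp add: sum_fun_apply tensor2_def)
  then show False using \<phi>(2) assms(2) by (simp add: linear_sum_apply[OF \<phi>(1)])
qed

theorem tensor3_universal:
  assumes "trilinear_map sA sB sC sU F" and "(\<Sum>i\<in>I. tensor3 sA sB sC (a i) (b i) (c i)) = 0"
  shows "(\<Sum>i\<in>I. F (a i) (b i) (c i)) = 0"
proof (rule ccontr)
  assume nz: "\<not> ?thesis"
  have "vector_space sU"
    using assms(1) by (auto simp: trilinear_map_def Vector_Spaces.linear_def)
  from forms_separate[OF this nz] obtain \<phi>
    where \<phi>: "Vector_Spaces.linear sU (*) \<phi>" "\<phi> (\<Sum>i\<in>I. F (a i) (b i) (c i)) = 1" .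
  have "trilinear_map sA sB sC (*) (\<lambda>a b c. \<phi> (F a b c))"
    using assms(1) \<phi>(1) by (auto simp: trilinear_map_def intro!: linear_compose_form[OF _ \<phi>(1)])
  then have "(\<Sum>i\<in>I. \<phi> (F (a i) (b i) (c i)))
      = (\<Sum>i\<in>I. tensor3 sA sB sC (a i) (b i) (c i)) (\<lambda>a b c. \<phi> (F a b c))"
    by (simp add: sum_fun_apply tensor3_def)
  then show False using \<phi>(2) assms(2) by (simp add: linear_sum_apply[OF \<phi>(1)])
qed

lemma linear_eval:
  assumes "Vector_Spaces.linear s (fun_scale :: 'k::field \<Rightarrow> _) f"
  shows "Vector_Spaces.linear s (*) (\<lambda>a. f a x)"
proof -
  interpret Vector_Spaces.linear s fun_scale f by fact
  show ?thesis
    by unfold_locales (auto simp: add scale fun_scale_def algebra_simps)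
qed

lemma lift2_sum_tensor2:
  assumes "bilinear_map sA sB fun_scale F"
  shows "lift2 F (\<Sum>i\<in>I. tensor2 sA sB (a i) (b i)) = (\<Sum>i\<in>I. F (a i) (b i))"
proof
  fix x
  have "bilinear_map sA sB (*) (\<lambda>a b. F a b x)"
    using assms by (auto simp: bilinear_map_def intro!: linear_eval)
  then show "lift2 F (\<Sum>i\<in>I. tensor2 sA sB (a i) (b i)) x = (\<Sum>i\<in>I. F (a i) (b i)) x"
    by (simp add: lift2_def sum_fun_apply tensor2_def)
qed

lemma lift3_sum_tensor3:
  assumes "trilinear_map sA sB sC fun_scale F"
  shows "lift3 F (\<Sum>i\<in>I. tensor3 sA sB sC (a i) (b i) (c i)) = (\<Sum>i\<in>I. F (a i) (b i) (c i))"
proof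
  fix x
  have "trilinear_map sA sB sC (*) (\<lambda>a b c. F a b c x)"
    using assms by (auto simp: trilinear_map_def intro!: linear_eval)
  then show "lift3 F (\<Sum>i\<in>I. tensor3 sA sB sC (a i) (b i) (c i)) x
      = (\<Sum>i\<in>I. F (a i) (b i) (c i)) x"
    by (simp add: lift3_def sum_fun_apply tensor3_def)
qed


section \<open>2-bialgebras\<close>

text \<open>
  \<open>'a\<close> with scalar multiplication \<open>s0\<close> is \<open>\<G>\<^sub>0\<close>, and \<open>'b\<close> with \<open>s1\<close> is \<open>\<G>\<^sub>-\<^sub>1\<close>.  The class \<open>ring\<close>
  does not include a unit.
\<close>

locale two_algebra =
  fixes s0 :: "'k::field \<Rightarrow> 'a::ring \<Rightarrow> 'a"
    and s1 :: "'k \<Rightarrow> 'b::ring \<Rightarrow> 'b"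
    and t :: "'b \<Rightarrow> 'a"
    and lact :: "'a \<Rightarrow> 'b \<Rightarrow> 'b" (infixl "\<rhd>" 70)
    and ract :: "'b \<Rightarrow> 'a \<Rightarrow> 'b" (infixl "\<lhd>" 70)
  assumes finite_dim0: "\<exists>B. finite_dimensional_vector_space s0 B"
    and finite_dim1: "\<exists>B. finite_dimensional_vector_space s1 B"
    and bilinear_mult0: "bilinear_map s0 s0 s0 (*)"
    and bilinear_mult1: "bilinear_map s1 s1 s1 (*)"
    and linear_t: "Vector_Spaces.linear s1 s0 t"
    and t_mult: "t (y * y') = t y * t y'"
    and bilinear_lact: "bilinear_map s0 s1 s1 (\<rhd>)"
    and bilinear_ract: "bilinear_map s1 s0 s1 (\<lhd>)"
    and lact_mult: "(x' * x) \<rhd> y = x' \<rhd> (x \<rhd> y)"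
    and lact_ract: "(x \<rhd> y) \<lhd> x' = x \<rhd> (y \<lhd> x')"
    and ract_mult: "y \<lhd> (x * x') = (y \<lhd> x) \<lhd> x'"
    and t_lact: "t (x \<rhd> y) = x * t y"
    and t_ract: "t (y \<lhd> x) = t y * x"
    and peiffer_left: "t y \<rhd> y' = y * y'"
    and peiffer_right: "y \<lhd> t y' = y * y'"

locale unital_two_algebra = two_algebra s0 s1 t lact ract
  for s0 :: "'k::field \<Rightarrow> 'a::ring \<Rightarrow> 'a"
    and s1 :: "'k \<Rightarrow> 'b::ring \<Rightarrow> 'b"
    and t :: "'b \<Rightarrow> 'a"
    and lact :: "'a \<Rightarrow> 'b \<Rightarrow> 'b" (infixl "\<rhd>" 70)
    and ract :: "'b \<Rightarrow> 'a \<Rightarrow> 'b" (infixl "\<lhd>" 70) +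
  fixes \<eta>0 :: 'a and \<eta>1 :: 'b
  assumes unit0: "\<eta>0 * x = x" "x * \<eta>0 = x"
    and unit1: "\<eta>1 * y = y" "y * \<eta>1 = y"
    and t_unit: "t \<eta>1 = \<eta>0"
    and unit_act: "\<eta>0 \<rhd> y = y" "y \<lhd> \<eta>0 = y"

text \<open>
  \<open>\<Delta>\<^sub>0 = \<Delta>l + \<Delta>r\<close> takes values in the direct sum \<open>(\<G>\<^sub>-\<^sub>1 \<otimes> \<G>\<^sub>0) \<oplus> (\<G>\<^sub>0 \<otimes> \<G>\<^sub>-\<^sub>1)\<close>, so the axiom
  \<open>(t \<otimes> 1 + 1 \<otimes> t) \<Delta>\<^sub>-\<^sub>1 = \<Delta>\<^sub>0 t\<close> is stated by its two components.
\<close>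

locale two_coalgebra =
  fixes s0 :: "'k::field \<Rightarrow> 'a::ab_group_add \<Rightarrow> 'a"
    and s1 :: "'k \<Rightarrow> 'b::ab_group_add \<Rightarrow> 'b"
    and t :: "'b \<Rightarrow> 'a"
    and \<Delta>1 :: "'b \<Rightarrow> ('k, 'b, 'b) tensor2"
    and \<Delta>l :: "'a \<Rightarrow> ('k, 'b, 'a) tensor2"
    and \<Delta>r :: "'a \<Rightarrow> ('k, 'a, 'b) tensor2"
    and \<Delta>0' :: "'a \<Rightarrow> ('k, 'a, 'a) tensor2"
  assumes linear_comults:
      "Vector_Spaces.linear s1 fun_scale \<Delta>1" "Vector_Spaces.linear s0 fun_scale \<Delta>l"
      "Vector_Spaces.linear s0 fun_scale \<Delta>r" "Vector_Spaces.linear s0 fun_scale \<Delta>0'"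
    and comults_in:
      "\<Delta>1 y \<in> tensor_space2 s1 s1" "\<Delta>l x \<in> tensor_space2 s1 s0"
      "\<Delta>r x \<in> tensor_space2 s0 s1" "\<Delta>0' x \<in> tensor_space2 s0 s0"
    and linear_t_coalg: "Vector_Spaces.linear s1 s0 t"
    and coassoc1: "split_left s1 s1 s1 \<Delta>1 (\<Delta>1 y) = split_right s1 s1 s1 \<Delta>1 (\<Delta>1 y)"
    and coassoc0: "split_left s0 s0 s0 \<Delta>0' (\<Delta>0' x) = split_right s0 s0 s0 \<Delta>0' (\<Delta>0' x)"
    and coassoc_l: "split_left s1 s1 s0 \<Delta>1 (\<Delta>l x) = split_right s1 s1 s0 \<Delta>l (\<Delta>l x)"
    and coassoc_r: "split_right s0 s1 s1 \<Delta>1 (\<Delta>r x) = split_left s0 s1 s1 \<Delta>r (\<Delta>r x)"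
    and coassoc_lr: "split_right s1 s0 s1 \<Delta>r (\<Delta>l x) = split_left s1 s0 s1 \<Delta>l (\<Delta>r x)"
    and t_comult: "map2 s0 s0 t t (\<Delta>1 y) = \<Delta>0' (t y)"
    and t_comult_l: "map2 s1 s0 id t (\<Delta>1 y) = \<Delta>l (t y)"
    and t_comult_r: "map2 s0 s1 t id (\<Delta>1 y) = \<Delta>r (t y)"
    and comult_l_t: "map2 s0 s0 t id (\<Delta>l x) = \<Delta>0' x"
    and comult_r_t: "map2 s0 s0 id t (\<Delta>r x) = \<Delta>0' x"

locale unital_two_bialgebra =
  unital_two_algebra s0 s1 t lact ract \<eta>0 \<eta>1 + two_coalgebra s0 s1 t \<Delta>1 \<Delta>l \<Delta>r \<Delta>0'
  for s0 :: "'k::field \<Rightarrow> 'a::ring \<Rightarrow> 'a"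
    and s1 :: "'k \<Rightarrow> 'b::ring \<Rightarrow> 'b"
    and t :: "'b \<Rightarrow> 'a"
    and lact :: "'a \<Rightarrow> 'b \<Rightarrow> 'b" (infixl "\<rhd>" 70)
    and ract :: "'b \<Rightarrow> 'a \<Rightarrow> 'b" (infixl "\<lhd>" 70)
    and \<eta>0 :: 'a and \<eta>1 :: 'b
    and \<Delta>1 :: "'b \<Rightarrow> ('k, 'b, 'b) tensor2"
    and \<Delta>l :: "'a \<Rightarrow> ('k, 'b, 'a) tensor2"
    and \<Delta>r :: "'a \<Rightarrow> ('k, 'a, 'b) tensor2"
    and \<Delta>0' :: "'a \<Rightarrow> ('k, 'a, 'a) tensor2" +
  assumes comult_lact: "\<Delta>1 (x \<rhd> y) = mul2 s1 s1 (\<rhd>) (\<rhd>) (\<Delta>0' x) (\<Delta>1 y)"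
    and comult_ract: "\<Delta>1 (y \<lhd> x) = mul2 s1 s1 (\<lhd>) (\<lhd>) (\<Delta>1 y) (\<Delta>0' x)"
    and comult_l_mult: "\<Delta>l (x * x') = mul2 s1 s0 (*) (*) (\<Delta>l x) (\<Delta>l x')"
    and comult_r_mult: "\<Delta>r (x * x') = mul2 s0 s1 (*) (*) (\<Delta>r x) (\<Delta>r x')"

text \<open>
  The idle legs of \<open>R\<^sub>1\<^sub>2, R\<^sub>1\<^sub>3, R\<^sub>2\<^sub>3\<close> carry the unit \<open>\<eta>0\<close> of \<open>\<G>\<^sub>0\<close>.  Hence a leg on which \<open>\<eta>0\<close> meets
  an element of \<open>\<G>\<^sub>-\<^sub>1\<close> is multiplied by an action (which there is the identity); on the leg common
  to \<open>R\<^sup>l\<close> and \<open>R\<^sup>r\<close> the action is the one indicated by the dot, \<open>\<rhd>\<close> for \<open>\<cdot>\<^sub>l\<close> and \<open>\<lhd>\<close> for \<open>\<cdot>\<^sub>r\<close>.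
\<close>

locale quasitriangular_two_bialgebra =
  unital_two_bialgebra s0 s1 t lact ract \<eta>0 \<eta>1 \<Delta>1 \<Delta>l \<Delta>r \<Delta>0'
  for s0 :: "'k::field \<Rightarrow> 'a::ring \<Rightarrow> 'a"
    and s1 :: "'k \<Rightarrow> 'b::ring \<Rightarrow> 'b"
    and t :: "'b \<Rightarrow> 'a"
    and lact :: "'a \<Rightarrow> 'b \<Rightarrow> 'b" (infixl "\<rhd>" 70)
    and ract :: "'b \<Rightarrow> 'a \<Rightarrow> 'b" (infixl "\<lhd>" 70)
    and \<eta>0 :: 'a and \<eta>1 :: 'b
    and \<Delta>1 :: "'b \<Rightarrow> ('k, 'b, 'b) tensor2"
    and \<Delta>l :: "'a \<Rightarrow> ('k, 'b, 'a) tensor2"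
    and \<Delta>r :: "'a \<Rightarrow> ('k, 'a, 'b) tensor2"
    and \<Delta>0' :: "'a \<Rightarrow> ('k, 'a, 'a) tensor2" +
  fixes Rl :: "('k, 'b, 'a) tensor2" and Rr :: "('k, 'a, 'b) tensor2"
  assumes R_in: "Rl \<in> tensor_space2 s1 s0" "Rr \<in> tensor_space2 s0 s1"
    and Rl_invertible: "\<exists>S \<in> tensor_space2 s1 s0.
      mul2 s1 s0 (*) (*) Rl S = tensor2 s1 s0 \<eta>1 \<eta>0 \<and>
      mul2 s1 s0 (*) (*) S Rl = tensor2 s1 s0 \<eta>1 \<eta>0"
    and Rr_invertible: "\<exists>S \<in> tensor_space2 s0 s1.
      mul2 s0 s1 (*) (*) Rr S = tensor2 s0 s1 \<eta>0 \<eta>1 \<and>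
      mul2 s0 s1 (*) (*) S Rr = tensor2 s0 s1 \<eta>0 \<eta>1"
    and split_l_Rr: "split_left s1 s0 s1 \<Delta>l Rr =
      mul3 s1 s0 s1 (\<lhd>) (*) (\<rhd>) (leg13 s1 s0 s0 \<eta>0 Rl) (leg23 s0 s0 s1 \<eta>0 Rr)"
    and split_r_Rr: "split_left s0 s1 s1 \<Delta>r Rr =
      mul3 s0 s1 s1 (*) (\<rhd>) (\<lhd>) (leg13 s0 s0 s1 \<eta>0 Rr) (leg23 s0 s1 s0 \<eta>0 Rl)"
    and split_l_Rl: "split_right s1 s1 s0 \<Delta>l Rl =
      mul3 s1 s1 s0 (\<lhd>) (\<rhd>) (*) (leg13 s1 s0 s0 \<eta>0 Rl) (leg12 s0 s1 s0 \<eta>0 Rr)"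
    and split_r_Rl: "split_right s1 s0 s1 \<Delta>r Rl =
      mul3 s1 s0 s1 (\<rhd>) (*) (\<lhd>) (leg13 s0 s0 s1 \<eta>0 Rr) (leg12 s1 s0 s0 \<eta>0 Rl)"
    and Rr_comult: "mul2 s0 s1 (*) (*) Rr (\<Delta>r x) = mul2 s0 s1 (*) (*) (swap2 s0 s1 (\<Delta>l x)) Rr"
    and Rl_comult: "mul2 s1 s0 (*) (*) Rl (\<Delta>l x) = mul2 s1 s0 (*) (*) (swap2 s1 s0 (\<Delta>r x)) Rl"
    and t_R: "map2 s0 s0 t id Rl = map2 s0 s0 id t Rr"

end

theory Submission
  imports Defs
begin

text \<open>
  On the two legs where \<open>\<Delta>\<close> takes its values, \<open>R\<close> turns \<open>\<Delta>\<^sub>0\<^sup>r\<close> into the flip of \<open>\<Delta>\<^sub>0\<^sup>l\<close> (or conversely):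
  \<open>R\<^sup>r\<^sub>2\<^sub>3 (id \<otimes> \<Delta>\<^sub>0\<^sup>r) R\<^sup>l = (id \<otimes> R\<^sup>r \<Delta>\<^sub>0\<^sup>r) R\<^sup>l = (id \<otimes> \<sigma>\<Delta>\<^sub>0\<^sup>l R\<^sup>r) R\<^sup>l = ((id \<otimes> \<sigma>\<Delta>\<^sub>0\<^sup>l) R\<^sup>l) R\<^sup>r\<^sub>2\<^sub>3\<close>.
  By axiom 1 the two coproducts are the products of two \<open>R\<close>'s in the first Yang--Baxter equation,
  the second one after exchanging legs 2 and 3.  The other three equations arise in the same way.
  As tensors are functionals on multilinear forms, a permutation of the legs is a permutation of
  the arguments of the forms.
\<close>

section \<open>Tensors as functionals on multilinear forms\<close>

lemma form_linearI:
  assumes "vector_space s" "\<And>x y. f (x + y) = f x + f y" "\<And>c x. f (s c x) = c * f x"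
  shows "Vector_Spaces.linear s ((*) :: 'k::field \<Rightarrow> _) f"
  using assms
  by (simp add: Vector_Spaces.linear_def module_hom_iff vector_space_def module_def algebra_simps)

lemma form_linearD:
  assumes "Vector_Spaces.linear s ((*) :: 'k::field \<Rightarrow> _) f"
  shows "f (x + y) = f x + f y" "f (s c x) = c * f x"
  using assms by (simp_all add: Vector_Spaces.linear_def module_hom_iff)

lemma linear_domain: "Vector_Spaces.linear s s' f \<Longrightarrow> vector_space s"
  by (simp add: Vector_Spaces.linear_def)

lemma bilinear_map_spaces:
  assumes "bilinear_map sA sB sC F"
  shows "vector_space sA" "vector_space sB" "vector_space sC"
  using assms by (auto simp: bilinear_map_def Vector_Spaces.linear_def)

lemma bilinear_map_evalL: "bilinear_map sA sB sC F \<Longrightarrow> Vector_Spaces.linear sA sC (\<lambda>a. F a b)"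
  and bilinear_map_evalR: "bilinear_map sA sB sC F \<Longrightarrow> Vector_Spaces.linear sB sC (\<lambda>b. F a b)"
  by (auto simp: bilinear_map_def)

lemma bilinear_map_flip:
  "bilinear_map sB sA sC (\<lambda>b a. F a b) \<longleftrightarrow> bilinear_map sA sB sC F"
  by (auto simp: bilinear_map_def)

lemma trilinear_map_flip23:
  "trilinear_map sA sC sB sD (\<lambda>a c b. F a b c) \<longleftrightarrow> trilinear_map sA sB sC sD F"
  by (auto simp: trilinear_map_def)

lemma trilinear_map_flip12:
  "trilinear_map sB sA sC sD (\<lambda>b a c. F a b c) \<longleftrightarrow> trilinear_map sA sB sC sD F"
  by (auto simp: trilinear_map_def)

lemma trilinear_map_rotate:
  "trilinear_map sC sA sB sD (\<lambda>c a b. F a b c) \<longleftrightarrow> trilinear_map sA sB sC sD F"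
  by (auto simp: trilinear_map_def)

text \<open>This holds for every \<open>\<beta>\<close>: the form is \<open>\<beta>\<close> itself
  when \<open>\<beta>\<close> is trilinear, and zero otherwise.\<close>

lemma trilinear_tensor3_eval:
  assumes "vector_space sA" "vector_space sB" "vector_space sC"
  shows "trilinear_map sA sB sC (*) (\<lambda>a b c. tensor3 sA sB sC a b c \<beta>)"
  using trilinear_map_tensor3[OF assms]
  by (auto simp: trilinear_map_def intro: linear_eval[where x = \<beta>])

lemma bilinear_tensor3_eval23:
  assumes "vector_space sA" "vector_space sB" "vector_space sC"
  shows "bilinear_map sB sC (*) (\<lambda>b c. tensor3 sA sB sC a b c \<beta>)"
  using trilinear_tensor3_eval[OF assms] by (auto simp: trilinear_map_def bilinear_map_def)

lemma bilinear_tensor3_eval12: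
  assumes "vector_space sA" "vector_space sB" "vector_space sC"
  shows "bilinear_map sA sB (*) (\<lambda>a b. tensor3 sA sB sC a b c \<beta>)"
  using trilinear_tensor3_eval[OF assms] by (auto simp: trilinear_map_def bilinear_map_def)

section \<open>Expansion of tensors into finite sums and interchange of evaluations\<close>

lemma tensor_space2_eval:
  fixes r :: "('k::field, 'a::ab_group_add, 'b::ab_group_add) tensor2"
  assumes "r \<in> tensor_space2 sA sB"
  obtains ps where "\<And>F. bilinear_map sA sB (*) F \<Longrightarrow> r F = (\<Sum>(a, b)\<leftarrow>ps. F a b)"
proof -
  interpret T: vector_space "fun_scale :: 'k \<Rightarrow> ('k, 'a, 'b) tensor2 \<Rightarrow> _"
    by (rule vector_space_fun_scale)
  \<comment> \<open>The expansion is claimed on bilinear \<open>F\<close> only: a tensor vanishes on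
    all other functions, where the finite sum need not. With lists, addition of tensors becomes
    concatenation.\<close>
  let ?P = "\<lambda>r. \<exists>ps. \<forall>F. bilinear_map sA sB (*) F \<longrightarrow> r F = (\<Sum>(a, b)\<leftarrow>ps. F a b)"
  have "r \<in> T.span {tensor2 sA sB a b | a b. True}"
    using assms by (simp add: tensor_space2_def)
  then have "?P r"
  proof (induction rule: T.span_induct)
    case base
    show ?case
    proof (rule T.subspaceI)
      show "0 \<in> Collect ?P" by (auto intro: exI[of _ "[]"])
    next
      fix x y assume "x \<in> Collect ?P" "y \<in> Collect ?P"
      then obtain ps qs where
        "\<forall>F. bilinear_map sA sB (*) F \<longrightarrow> x F = (\<Sum>(a, b)\<leftarrow>ps. F a b)"
        "\<forall>F. bilinear_map sA sB (*) F \<longrightarrow> y F = (\<Sum>(a, b)\<leftarrow>qs. F a b)" by blast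
      then show "x + y \<in> Collect ?P" by (auto intro!: exI[of _ "ps @ qs"])
    next
      fix c x assume "x \<in> Collect ?P"
      then obtain ps where
        ps: "\<forall>F. bilinear_map sA sB (*) F \<longrightarrow> x F = (\<Sum>(a, b)\<leftarrow>ps. F a b)" by blast
      \<comment> \<open>The scalar is absorbed into the first entry of each pair.\<close>
      have "c * (\<Sum>(a, b)\<leftarrow>ps. F a b) = (\<Sum>(a, b)\<leftarrow>map (\<lambda>(a, b). (sA c a, b)) ps. F a b)"
        if "bilinear_map sA sB (*) F" for F
        using form_linearD(2)[OF bilinear_map_evalL[OF that]]
        by (induction ps) (auto simp: algebra_simps)
      with ps show "fun_scale c x \<in> Collect ?P"
        by (auto simp: fun_scale_def intro!: exI[of _ "map (\<lambda>(a, b). (sA c a, b)) ps"])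
    qed
  next
    case (step x)
    then obtain a b where "x = tensor2 sA sB a b" by blast
    then show ?case by (auto simp: tensor2_def intro!: exI[of _ "[(a, b)]"])
  qed
  then show ?thesis using that by blast
qed

text \<open>A tensor acts on bilinear forms as a finite sum of point evaluations, each linear in the
  parameter \<open>p\<close>. This gives the multilinearity of forms that arise by evaluating an
  inner tensor first.\<close>

lemma linear_tensor_eval:
  assumes "r \<in> tensor_space2 sA sB" and "vector_space s"
    and F: "\<And>p. bilinear_map sA sB (*) (F p)"
    and lin: "\<And>a b. Vector_Spaces.linear s (*) (\<lambda>p. F p a b)"
  shows "Vector_Spaces.linear s (*) (\<lambda>p. r (F p))"
proof -
  from tensor_space2_eval[OF assms(1)] obtain ps
    where ps: "\<And>F. bilinear_map sA sB (*) F \<Longrightarrow> r F = (\<Sum>(a, b)\<leftarrow>ps. F a b)" by blast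
  have "Vector_Spaces.linear s (*) (\<lambda>p. \<Sum>(a, b)\<leftarrow>ps. F p a b)"
    by (rule form_linearI[OF assms(2)]; induction ps)
      (auto simp: form_linearD[OF lin] algebra_simps)
  then show ?thesis by (simp add: ps[OF F])
qed

lemma sum_list_swap:
  "(\<Sum>p\<leftarrow>ps. \<Sum>q\<leftarrow>qs. f p q) = (\<Sum>q\<leftarrow>qs. \<Sum>p\<leftarrow>ps. f p q :: 'k::comm_monoid_add)"
  by (induction ps) (auto simp: sum_list_addf)

text \<open>A Fubini argument: both sides are the same finite double sum.\<close>

lemma tensor_eval_swap:
  assumes r: "r \<in> tensor_space2 sA sB" and r': "r' \<in> tensor_space2 sC sD"
    and F1: "\<And>a b. bilinear_map sC sD (*) (\<lambda>c d. F a b c d)"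
    and F2: "\<And>c d. bilinear_map sA sB (*) (\<lambda>a b. F a b c d)"
  shows "r (\<lambda>a b. r' (\<lambda>c d. F a b c d)) = r' (\<lambda>c d. r (\<lambda>a b. F a b c d))"
proof -
  from tensor_space2_eval[OF r] obtain ps
    where ps: "\<And>F. bilinear_map sA sB (*) F \<Longrightarrow> r F = (\<Sum>(a, b)\<leftarrow>ps. F a b)" by blast
  from tensor_space2_eval[OF r'] obtain qs
    where qs: "\<And>F. bilinear_map sC sD (*) F \<Longrightarrow> r' F = (\<Sum>(a, b)\<leftarrow>qs. F a b)" by blast
  \<comment> \<open>The outer tensor expands into a sum only on a bilinear form, so the result of
    the inner evaluation must be bilinear, in either order.\<close>
  have "bilinear_map sA sB (*) (\<lambda>a b. r' (F a b))"
    using bilinear_map_spaces[OF F2] F1 F2 unfolding bilinear_map_def[of sA sB]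
    by (auto intro!: linear_tensor_eval[OF r'])
  moreover have "bilinear_map sC sD (*) (\<lambda>c d. r (\<lambda>a b. F a b c d))"
    using bilinear_map_spaces[OF F1] F1 F2 unfolding bilinear_map_def[of sC sD]
    by (auto intro!: linear_tensor_eval[OF r])
  ultimately show ?thesis
    using sum_list_swap[of "\<lambda>p q. F (fst p) (snd p) (fst q) (snd q)" qs ps]
    by (simp add: ps qs F1 F2 case_prod_unfold)
qed

section \<open>Evaluation and composition of multilinear forms\<close>

lemma tensor2_apply: "bilinear_map sA sB (*) \<beta> \<Longrightarrow> tensor2 sA sB a b \<beta> = \<beta> a b"
  by (simp add: tensor2_def)

lemma tensor3_apply: "trilinear_map sA sB sC (*) \<beta> \<Longrightarrow> tensor3 sA sB sC a b c \<beta> = \<beta> a b c"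
  by (simp add: tensor3_def)

lemma linear_compose_bilinearL:
  assumes "bilinear_map sA sB sC f" "Vector_Spaces.linear sC s' g"
  shows "Vector_Spaces.linear sA s' (\<lambda>a. g (f a b))"
  using assms by (auto intro: linear_compose_form[where g = g] bilinear_map_evalL)

lemma linear_compose_bilinearR:
  assumes "bilinear_map sA sB sC f" "Vector_Spaces.linear sC s' g"
  shows "Vector_Spaces.linear sB s' (\<lambda>b. g (f a b))"
  using assms by (auto intro: linear_compose_form[where g = g] bilinear_map_evalR)

text \<open>These are the forms seen by the two factors of \<open>mul3\<close>: the first while the
  arguments of the second are fixed, and conversely.\<close>

lemma trilinear_map_compose:
  assumes T: "trilinear_map sA sB sC sE T"
    and h: "bilinear_map sA1 sA2 sA h" and f: "bilinear_map sB1 sB2 sB f"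
    and g: "bilinear_map sC1 sC2 sC g"
  shows "trilinear_map sA1 sB1 sC1 sE (\<lambda>a b c. T (h a a') (f b b') (g c c'))"
    and "trilinear_map sA2 sB2 sC2 sE (\<lambda>a' b' c'. T (h a a') (f b b') (g c c'))"
  using T unfolding trilinear_map_def
  by (auto intro!: linear_compose_bilinearL[OF h] linear_compose_bilinearL[OF f]
      linear_compose_bilinearL[OF g] linear_compose_bilinearR[OF h] linear_compose_bilinearR[OF f]
      linear_compose_bilinearR[OF g])

lemma trilinear_map_bilinear23:
  "trilinear_map sA sB sC sE T \<Longrightarrow> bilinear_map sB sC sE (\<lambda>b c. T a b c)"
  by (auto simp: trilinear_map_def bilinear_map_def)

section \<open>Products with a comultiplied tensor\<close>

text \<open>The idle leg of \<open>R\<close> carries \<open>u\<close>, which \<open>h\<close>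
  absorbs on the right, so only legs 2 and 3 are multiplied. Both sides evaluate \<open>S\<close>,
  then \<open>D x\<close>, then \<open>R\<close>, hence no interchange is involved.\<close>

lemma mul3_split_right_leg23:
  assumes R: "R \<in> tensor_space2 sB2 sC2"
    and h: "bilinear_map sA sU sA h" and f: "bilinear_map sB1 sB2 sB f"
    and g: "bilinear_map sC1 sC2 sC g"
    and unit: "\<And>a. h a u = a"
  shows "mul3 sA sB sC h f g (split_right sA sB1 sC1 D S) (leg23 sU sB2 sC2 u R) =
    split_right sA sB sC (\<lambda>x. mul2 sB sC f g (D x) R) S"
proof
  fix \<beta>
  note vs = bilinear_map_spaces[OF h] bilinear_map_spaces[OF f] bilinear_map_spaces[OF g]
  \<comment> \<open>Equality of tensors is tested on all functions \<open>\<beta>\<close>, trilinear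
    or not. Passing to \<open>T\<close>, which is always trilinear, avoids a case
    distinction.\<close>
  define T where "T = (\<lambda>a b c. tensor3 sA sB sC a b c \<beta>)"
  have T_eq: "tensor3 sA sB sC a b c \<beta> = T a b c" for a b c
    by (simp add: T_def)
  have T: "trilinear_map sA sB sC (*) T"
    unfolding T_def using vs by (intro trilinear_tensor3_eval)
  note hfg = trilinear_map_compose[OF T h f g]
  \<comment> \<open>Setting the argument on the idle leg to \<open>u\<close> removes
    \<open>h\<close> from the form.\<close>
  have "bilinear_map sB2 sC2 (*) (\<lambda>b' c'. T a (f b b') (g c c'))" for a b c
    using trilinear_map_bilinear23[OF hfg(2)[of a b c], of u] by (simp add: unit)
  moreover have "trilinear_map sA sB1 sC1 (*) (\<lambda>a b c. T a (f b b') (g c c'))" for b' c'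
    using hfg(1)[of u b' c'] by (simp add: unit)
  \<comment> \<open>Since \<open>tensor3\<close> is zero on functions that are not trilinear, the
    form left after evaluating \<open>R\<close> must be shown trilinear before
    \<open>split_right\<close> can be evaluated on it.\<close>
  ultimately have "trilinear_map sA sB1 sC1 (*) (\<lambda>a b c. R (\<lambda>b' c'. T a (f b b') (g c c')))"
    using vs unfolding trilinear_map_def
    by (auto intro!: linear_tensor_eval[OF R])
  then show "mul3 sA sB sC h f g (split_right sA sB1 sC1 D S) (leg23 sU sB2 sC2 u R) \<beta> =
      split_right sA sB sC (\<lambda>x. mul2 sB sC f g (D x) R) S \<beta>"
    by (simp add: mul3_def split_right_def leg23_def mul2_def lift2_def lift3_def unit
        tensor3_apply tensor2_apply trilinear_map_bilinear23[OF T] hfg T_eq)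
qed

text \<open>The mirror image of the previous lemma, with one difference: the left side evaluates
  \<open>R\<close> before \<open>S\<close>, the right side \<open>S\<close> before \<open>R\<close>.
  The interchange is why \<open>S\<close> and the values of \<open>D\<close> must be tensors and
  \<open>D\<close> linear.\<close>

lemma mul3_leg23_split_right:
  assumes R: "R \<in> tensor_space2 sB1 sC1" and S: "S \<in> tensor_space2 sA sX"
    and D: "Vector_Spaces.linear sX fun_scale D" "\<And>x. D x \<in> tensor_space2 sB2 sC2"
    and h: "bilinear_map sU sA sA h" and f: "bilinear_map sB1 sB2 sB f"
    and g: "bilinear_map sC1 sC2 sC g"
    and unit: "\<And>a. h u a = a"
  shows "mul3 sA sB sC h f g (leg23 sU sB1 sC1 u R) (split_right sA sB2 sC2 D S) =
    split_right sA sB sC (\<lambda>x. mul2 sB sC f g R (D x)) S"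
proof
  fix \<beta>
  note vs = bilinear_map_spaces[OF h] bilinear_map_spaces[OF f] bilinear_map_spaces[OF g]
    linear_domain[OF D(1)]
  define T where "T = (\<lambda>a b c. tensor3 sA sB sC a b c \<beta>)"
  have T_eq: "tensor3 sA sB sC a b c \<beta> = T a b c" for a b c
    by (simp add: T_def)
  have T: "trilinear_map sA sB sC (*) T"
    unfolding T_def using vs by (intro trilinear_tensor3_eval)
  note hfg = trilinear_map_compose[OF T h f g]
  have hfg': "trilinear_map sA sB2 sC2 (*) (\<lambda>a b' c'. T a (f b b') (g c c'))" for b c
    using hfg(2)[of u b c] by (simp add: unit)
  have hfg1: "bilinear_map sB1 sC1 (*) (\<lambda>b c. T a (f b b') (g c c'))" for a b' c'
    using trilinear_map_bilinear23[OF hfg(1)[of a b' c'], of u] by (simp add: unit)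
  \<comment> \<open>The argument \<open>a0\<close> on the idle leg of \<open>R\<close> stays free,
    since evaluating \<open>leg23\<close> requires trilinearity in it as well; at
    \<open>a0 = u\<close> this is the form to be interchanged.\<close>
  have inner1: "bilinear_map sA sX (*) (\<lambda>a x. D x (\<lambda>b' c'. T (h a0 a) (f b b') (g c c')))"
    for a0 b c
    using vs hfg(2)[of a0 b c] trilinear_map_bilinear23[OF hfg(2)[of a0 b c]]
    unfolding bilinear_map_def[of sA sX] trilinear_map_def
    by (auto intro!: linear_tensor_eval[OF D(2)] linear_eval[OF D(1)])
  have inner2: "trilinear_map sU sB1 sC1 (*)
      (\<lambda>a0 b c. D x (\<lambda>b' c'. T (h a0 a) (f b b') (g c c')))" for a x
    using vs hfg(1)[of a] trilinear_map_bilinear23[OF hfg(2)]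
    unfolding trilinear_map_def by (auto intro!: linear_tensor_eval[OF D(2)])
  have inner3: "bilinear_map sB1 sC1 (*) (\<lambda>b c. D x (\<lambda>b' c'. T a (f b b') (g c c')))" for a x
    using trilinear_map_bilinear23[OF inner2[of x a], of u] by (simp add: unit)
  have "trilinear_map sU sB1 sC1 (*)
      (\<lambda>a0 b c. S (\<lambda>a x. D x (\<lambda>b' c'. T (h a0 a) (f b b') (g c c'))))"
    using vs inner1 inner2
    unfolding trilinear_map_def by (auto intro!: linear_tensor_eval[OF S])
  moreover have "R (\<lambda>b c. S (\<lambda>a x. D x (\<lambda>b' c'. T a (f b b') (g c c')))) =
      S (\<lambda>a x. R (\<lambda>b c. D x (\<lambda>b' c'. T a (f b b') (g c c'))))"
    using inner1[of u] inner3 by (intro tensor_eval_swap[OF R S]) (simp_all add: unit)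
  ultimately show "mul3 sA sB sC h f g (leg23 sU sB1 sC1 u R) (split_right sA sB2 sC2 D S) \<beta> =
      split_right sA sB sC (\<lambda>x. mul2 sB sC f g R (D x)) S \<beta>"
    by (simp add: mul3_def split_right_def leg23_def mul2_def lift2_def lift3_def unit
        tensor3_apply tensor2_apply trilinear_map_bilinear23[OF T] hfg hfg' T_eq)
qed

section \<open>Permutations of the legs\<close>

text \<open>Unlike \<open>swap2\<close>, this does not pass through \<open>tensor2\<close>: it only
  permutes the arguments of a form, so it needs no scalar multiplications and is involutive on all
  functionals. The two agree on bilinear forms.\<close>

definition flip2 :: "('k, 'a, 'b) tensor2 \<Rightarrow> ('k, 'b, 'a) tensor2" where
  "flip2 r = (\<lambda>\<beta>. r (\<lambda>a b. \<beta> b a))"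

definition flip12 :: "('k, 'a, 'b, 'c) tensor3 \<Rightarrow> ('k, 'b, 'a, 'c) tensor3" where
  "flip12 r = (\<lambda>\<beta>. r (\<lambda>a b c. \<beta> b a c))"

definition flip23 :: "('k, 'a, 'b, 'c) tensor3 \<Rightarrow> ('k, 'a, 'c, 'b) tensor3" where
  "flip23 r = (\<lambda>\<beta>. r (\<lambda>a b c. \<beta> a c b))"

definition rotate3 :: "('k, 'a, 'b, 'c) tensor3 \<Rightarrow> ('k, 'b, 'c, 'a) tensor3" where
  "rotate3 r = (\<lambda>\<beta>. r (\<lambda>a b c. \<beta> b c a))"

lemma flip2_tensor2: "flip2 (tensor2 sA sB a b) = tensor2 sB sA b a"
proof
  fix \<beta> show "flip2 (tensor2 sA sB a b) \<beta> = tensor2 sB sA b a \<beta>"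
    by (simp add: flip2_def tensor2_def bilinear_map_flip[where F = \<beta>])
qed

text \<open>
  As rewrite rules the next three facts loop unless \<open>\<beta>\<close> is instantiated: the left-hand side matches
  every form.
\<close>

lemma tensor3_flip12: "tensor3 sA sB sC a b c (\<lambda>a b c. \<beta> b a c) = tensor3 sB sA sC b a c \<beta>"
  by (simp add: tensor3_def trilinear_map_flip12[where F = \<beta>])

lemma tensor3_flip23: "tensor3 sA sB sC a b c (\<lambda>a b c. \<beta> a c b) = tensor3 sA sC sB a c b \<beta>"
  by (simp add: tensor3_def trilinear_map_flip23[where F = \<beta>])

lemma tensor3_rotate: "tensor3 sA sB sC a b c (\<lambda>a b c. \<beta> b c a) = tensor3 sB sC sA b c a \<beta>"
  by (simp add: tensor3_def trilinear_map_rotate[where F = \<beta>])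

lemmas tensor_op_defs = mul3_def split_right_def split_left_def leg12_def leg13_def leg23_def
  swap2_def lift2_def lift3_def flip2_def flip12_def flip23_def rotate3_def

text \<open>The flip is linear and sends pure tensors to pure tensors, hence one span into the
  other.\<close>

lemma flip2_in_tensor_space2:
  fixes r :: "('k::field, 'a::ab_group_add, 'b::ab_group_add) tensor2"
  assumes "r \<in> tensor_space2 sA sB"
  shows "flip2 r \<in> tensor_space2 sB sA"
proof -
  interpret T: vector_space "fun_scale :: 'k \<Rightarrow> ('k, 'a, 'b) tensor2 \<Rightarrow> _"
    by (rule vector_space_fun_scale)
  interpret T': vector_space "fun_scale :: 'k \<Rightarrow> ('k, 'b, 'a) tensor2 \<Rightarrow> _"
    by (rule vector_space_fun_scale)
  have lin: "Vector_Spaces.linear fun_scale fun_scale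
      (flip2 :: ('k, 'a, 'b) tensor2 \<Rightarrow> ('k, 'b, 'a) tensor2)"
    by unfold_locales (auto simp: flip2_def fun_scale_def fun_eq_iff)
  interpret L: Vector_Spaces.linear fun_scale fun_scale
    "flip2 :: ('k, 'a, 'b) tensor2 \<Rightarrow> ('k, 'b, 'a) tensor2" by (rule lin)
  have "flip2 ` {tensor2 sA sB a b | a b. True} \<subseteq> {tensor2 sB sA b a | b a. True}"
    by (auto simp: flip2_tensor2) blast
  then have "T'.span (flip2 ` {tensor2 sA sB a b | a b. True}) \<subseteq> tensor_space2 sB sA"
    unfolding tensor_space2_def by (rule T'.span_mono)
  then show ?thesis
    using assms L.span_image by (auto simp: tensor_space2_def)
qed

text \<open>A product is a nested evaluation ending in \<open>tensor3\<close>, so permuting the legs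
  only permutes the arguments of that innermost tensor. The order of the factors \<open>X\<close>
  and \<open>Y\<close> is kept.\<close>

lemma mul3_flip12: "flip12 (mul3 sA sB sC f g h X Y) = mul3 sB sA sC g f h (flip12 X) (flip12 Y)"
proof
  fix \<beta> show "(flip12 (mul3 sA sB sC f g h X Y)) \<beta> = (mul3 sB sA sC g f h (flip12 X) (flip12 Y)) \<beta>"
    by (simp add: tensor_op_defs tensor3_flip12[where \<beta> = \<beta>])
qed

lemma mul3_flip23: "flip23 (mul3 sA sB sC f g h X Y) = mul3 sA sC sB f h g (flip23 X) (flip23 Y)"
proof
  fix \<beta> show "(flip23 (mul3 sA sB sC f g h X Y)) \<beta> = (mul3 sA sC sB f h g (flip23 X) (flip23 Y)) \<beta>"
    by (simp add: tensor_op_defs tensor3_flip23[where \<beta> = \<beta>])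
qed

lemma mul3_rotate3:
  "rotate3 (mul3 sA sB sC f g h X Y) = mul3 sB sC sA g h f (rotate3 X) (rotate3 Y)"
proof
  fix \<beta> show "(rotate3 (mul3 sA sB sC f g h X Y)) \<beta> = (mul3 sB sC sA g h f (rotate3 X) (rotate3 Y)) \<beta>"
    by (simp add: tensor_op_defs tensor3_rotate[where \<beta> = \<beta>])
qed

lemma leg13_flip12: "flip12 (leg13 sA sB sC u r) = leg23 sB sA sC u r"
proof
  fix \<beta> show "(flip12 (leg13 sA sB sC u r)) \<beta> = (leg23 sB sA sC u r) \<beta>"
    by (simp add: tensor_op_defs tensor3_flip12[where \<beta> = \<beta>])
qed

lemma leg23_flip12: "flip12 (leg23 sA sB sC u r) = leg13 sB sA sC u r"
proof
  fix \<beta> show "(flip12 (leg23 sA sB sC u r)) \<beta> = (leg13 sB sA sC u r) \<beta>"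
    by (simp add: tensor_op_defs tensor3_flip12[where \<beta> = \<beta>])
qed

lemma leg12_flip23: "flip23 (leg12 sA sB sC u r) = leg13 sA sC sB u r"
proof
  fix \<beta> show "(flip23 (leg12 sA sB sC u r)) \<beta> = (leg13 sA sC sB u r) \<beta>"
    by (simp add: tensor_op_defs tensor3_flip23[where \<beta> = \<beta>])
qed

lemma leg13_flip23: "flip23 (leg13 sA sB sC u r) = leg12 sA sC sB u r"
proof
  fix \<beta> show "(flip23 (leg13 sA sB sC u r)) \<beta> = (leg12 sA sC sB u r) \<beta>"
    by (simp add: tensor_op_defs tensor3_flip23[where \<beta> = \<beta>])
qed

lemma leg23_rotate3: "rotate3 (leg23 sA sB sC u r) = leg12 sB sC sA u r"
proof
  fix \<beta> show "(rotate3 (leg23 sA sB sC u r)) \<beta> = (leg12 sB sC sA u r) \<beta>"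
    by (simp add: tensor_op_defs tensor3_rotate[where \<beta> = \<beta>])
qed

lemmas leg_flips = leg13_flip12 leg23_flip12 leg12_flip23 leg13_flip23 leg23_rotate3

text \<open>Rotation moves legs 2 and 3 to places 1 and 2. This reduces products with a coproduct on
  the left factor to the case of the right factor.\<close>

lemma split_left_rotate3:
  "split_left sB sC sA D S = rotate3 (split_right sA sB sC D (flip2 S))"
proof
  fix \<beta> show "(split_left sB sC sA D S) \<beta> = (rotate3 (split_right sA sB sC D (flip2 S))) \<beta>"
    by (simp add: tensor_op_defs tensor3_rotate[where \<beta> = \<beta>])
qed

text \<open>The vector space assumptions make \<open>tensor3\<close> bilinear in its last two
  arguments, so that the \<open>tensor2\<close> inside \<open>swap2\<close> evaluates instead of
  giving zero.\<close>

lemma flip23_split_right: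
  assumes "vector_space sA" "vector_space sB" "vector_space sC"
  shows "flip23 (split_right sA sC sB D S) = split_right sA sB sC (\<lambda>x. swap2 sB sC (D x)) S"
proof
  fix \<beta> show "(flip23 (split_right sA sC sB D S)) \<beta> = (split_right sA sB sC (\<lambda>x. swap2 sB sC (D x)) S) \<beta>"
    by (simp add: tensor_op_defs tensor3_flip23[where \<beta> = \<beta>] tensor2_apply bilinear_tensor3_eval23[OF assms])
qed

lemma flip12_split_left:
  assumes "vector_space sA" "vector_space sB" "vector_space sC"
  shows "flip12 (split_left sB sA sC D S) = split_left sA sB sC (\<lambda>x. swap2 sA sB (D x)) S"
proof
  fix \<beta> show "(flip12 (split_left sB sA sC D S)) \<beta> = (split_left sA sB sC (\<lambda>x. swap2 sA sB (D x)) S) \<beta>"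
    by (simp add: tensor_op_defs tensor3_flip12[where \<beta> = \<beta>] tensor2_apply bilinear_tensor3_eval12[OF assms])
qed

text \<open>This is the rotated form of \<open>mul3_split_right_leg23\<close>, whose idle first leg
  becomes the third.\<close>

lemma mul3_split_left_leg12:
  assumes "R \<in> tensor_space2 sA2 sB2"
    and "bilinear_map sA1 sA2 sA f" "bilinear_map sB1 sB2 sB g" "bilinear_map sC sU sC h"
    and "\<And>c. h c u = c"
  shows "mul3 sA sB sC f g h (split_left sA1 sB1 sC D S) (leg12 sA2 sB2 sU u R) =
    split_left sA sB sC (\<lambda>x. mul2 sA sB f g (D x) R) S"
  using arg_cong[OF mul3_split_right_leg23[OF assms(1,4,2,3,5), of D "flip2 S"], of rotate3]
  by (simp add: mul3_rotate3 leg_flips flip: split_left_rotate3)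

lemma mul3_leg12_split_left:
  assumes "R \<in> tensor_space2 sA1 sB1" "S \<in> tensor_space2 sX sC"
    and "Vector_Spaces.linear sX fun_scale D" "\<And>x. D x \<in> tensor_space2 sA2 sB2"
    and "bilinear_map sA1 sA2 sA f" "bilinear_map sB1 sB2 sB g" "bilinear_map sU sC sC h"
    and "\<And>c. h u c = c"
  shows "mul3 sA sB sC f g h (leg12 sA1 sB1 sU u R) (split_left sA2 sB2 sC D S) =
    split_left sA sB sC (\<lambda>x. mul2 sA sB f g R (D x)) S"
  using arg_cong[OF mul3_leg23_split_right[OF assms(1) flip2_in_tensor_space2[OF assms(2)]
      assms(3,4,7,5,6,8)], of rotate3]
  by (simp add: mul3_rotate3 leg_flips flip: split_left_rotate3)

section \<open>The 2-Yang--Baxter equations\<close>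

theorem proposition3p3:
  fixes s0 :: "'k::field \<Rightarrow> 'a::ring \<Rightarrow> 'a"
    and s1 :: "'k \<Rightarrow> 'b::ring \<Rightarrow> 'b"
    and t :: "'b \<Rightarrow> 'a"
    and lact :: "'a \<Rightarrow> 'b \<Rightarrow> 'b"
    and ract :: "'b \<Rightarrow> 'a \<Rightarrow> 'b"
    and \<eta>0 :: 'a and \<eta>1 :: 'b
    and \<Delta>1 :: "'b \<Rightarrow> ('k, 'b, 'b) tensor2"
    and \<Delta>l :: "'a \<Rightarrow> ('k, 'b, 'a) tensor2"
    and \<Delta>r :: "'a \<Rightarrow> ('k, 'a, 'b) tensor2"
    and \<Delta>0' :: "'a \<Rightarrow> ('k, 'a, 'a) tensor2"
    and Rl :: "('k, 'b, 'a) tensor2" and Rr :: "('k, 'a, 'b) tensor2"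
  defines "Rl12 \<equiv> leg12 s1 s0 s0 \<eta>0 Rl"
    and "Rl13 \<equiv> leg13 s1 s0 s0 \<eta>0 Rl"
    and "Rl23 \<equiv> leg23 s0 s1 s0 \<eta>0 Rl"
    and "Rr12 \<equiv> leg12 s0 s1 s0 \<eta>0 Rr"
    and "Rr13 \<equiv> leg13 s0 s0 s1 \<eta>0 Rr"
    and "Rr23 \<equiv> leg23 s0 s0 s1 \<eta>0 Rr"
  assumes "quasitriangular_two_bialgebra s0 s1 t lact ract \<eta>0 \<eta>1 \<Delta>1 \<Delta>l \<Delta>r \<Delta>0' Rl Rr"
  shows "(mul3 s1 s0 s1 lact (*) (*) Rr23 (mul3 s1 s0 s1 lact (*) ract Rr13 Rl12) =
      mul3 s1 s0 s1 ract (*) (*) (mul3 s1 s0 s1 ract (*) lact Rl12 Rr13) Rr23) \<and>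
    (mul3 s0 s1 s1 (*) (*) ract (mul3 s0 s1 s1 (*) ract lact Rl23 Rr13) Rr12 =
      mul3 s0 s1 s1 (*) (*) lact Rr12 (mul3 s0 s1 s1 (*) lact ract Rr13 Rl23)) \<and>
    (mul3 s1 s1 s0 lact (*) (*) Rl23 (mul3 s1 s1 s0 ract lact (*) Rl13 Rr12) =
      mul3 s1 s1 s0 ract (*) (*) (mul3 s1 s1 s0 lact ract (*) Rr12 Rl13) Rl23) \<and>
    (mul3 s1 s0 s1 (*) (*) ract (mul3 s1 s0 s1 lact (*) ract Rr23 Rl13) Rl12 =
      mul3 s1 s0 s1 (*) (*) lact Rl12 (mul3 s1 s0 s1 ract (*) lact Rl13 Rr23))"
proof -
  interpret quasitriangular_two_bialgebra s0 s1 t lact ract \<eta>0 \<eta>1 \<Delta>1 \<Delta>l \<Delta>r \<Delta>0' Rl Rr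
    by fact
  note bil = bilinear_mult0 bilinear_mult1 bilinear_lact bilinear_ract
  note vs = bilinear_map_spaces(1)[OF bilinear_mult0] bilinear_map_spaces(1)[OF bilinear_mult1]
  \<comment> \<open>Each is a factorisation from axiom 1 with the two legs of the coproduct
    exchanged. The flip preserves the order of the factors and the action used on the common leg,
    and only relabels the legs.\<close>
  have flipped:
    "split_right s1 s0 s1 (\<lambda>x. swap2 s0 s1 (\<Delta>l x)) Rl = mul3 s1 s0 s1 ract (*) lact Rl12 Rr13"
    "split_right s1 s1 s0 (\<lambda>x. swap2 s1 s0 (\<Delta>r x)) Rl = mul3 s1 s1 s0 lact ract (*) Rr12 Rl13"
    "split_left s0 s1 s1 (\<lambda>x. swap2 s0 s1 (\<Delta>l x)) Rr = mul3 s0 s1 s1 (*) ract lact Rl23 Rr13"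
    "split_left s1 s0 s1 (\<lambda>x. swap2 s1 s0 (\<Delta>r x)) Rr = mul3 s1 s0 s1 lact (*) ract Rr23 Rl13"
    unfolding assms(1-6)
    by (simp_all add: split_l_Rl split_r_Rl split_l_Rr split_r_Rr mul3_flip23 mul3_flip12 leg_flips
        vs flip: flip23_split_right flip12_split_left)
  have "mul3 s1 s0 s1 lact (*) (*) Rr23 (split_right s1 s0 s1 \<Delta>r Rl) =
      split_right s1 s0 s1 (\<lambda>x. mul2 s0 s1 (*) (*) Rr (\<Delta>r x)) Rl"
    unfolding Rr23_def
    by (rule mul3_leg23_split_right[OF R_in(2,1) linear_comults(3) comults_in(3)])
      (simp_all add: bil unit_act)
  \<comment> \<open>As \<open>Rr\<close> passes to the right, so does its idle unit, and
    \<open>lact\<close> on leg 1 becomes \<open>ract\<close>; both are the identity there.\<close>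
  also have "\<dots> = mul3 s1 s0 s1 ract (*) (*)
      (split_right s1 s0 s1 (\<lambda>x. swap2 s0 s1 (\<Delta>l x)) Rl) Rr23"
    unfolding Rr_comult Rr23_def
    by (rule mul3_split_right_leg23[symmetric, OF R_in(2)]) (simp_all add: bil unit_act)
  finally have 1: "mul3 s1 s0 s1 lact (*) (*) Rr23 (mul3 s1 s0 s1 lact (*) ract Rr13 Rl12) =
      mul3 s1 s0 s1 ract (*) (*) (mul3 s1 s0 s1 ract (*) lact Rl12 Rr13) Rr23"
    by (simp add: split_r_Rl flipped flip: Rr13_def Rl12_def)
  \<comment> \<open>Now the exchange takes place in legs 1 and 2, under the coproduct of the first
    leg of \<open>Rr\<close>. The computation runs from the right-hand side of the equation to the
    left-hand side.\<close>
  have "mul3 s0 s1 s1 (*) (*) lact Rr12 (split_left s0 s1 s1 \<Delta>r Rr) =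
      split_left s0 s1 s1 (\<lambda>x. mul2 s0 s1 (*) (*) Rr (\<Delta>r x)) Rr"
    unfolding Rr12_def
    by (rule mul3_leg12_split_left[OF R_in(2,2) linear_comults(3) comults_in(3)])
      (simp_all add: bil unit_act)
  also have "\<dots> = mul3 s0 s1 s1 (*) (*) ract
      (split_left s0 s1 s1 (\<lambda>x. swap2 s0 s1 (\<Delta>l x)) Rr) Rr12"
    unfolding Rr_comult Rr12_def
    by (rule mul3_split_left_leg12[symmetric, OF R_in(2)]) (simp_all add: bil unit_act)
  finally have 2: "mul3 s0 s1 s1 (*) (*) ract (mul3 s0 s1 s1 (*) ract lact Rl23 Rr13) Rr12 =
      mul3 s0 s1 s1 (*) (*) lact Rr12 (mul3 s0 s1 s1 (*) lact ract Rr13 Rl23)"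
    by (simp add: split_r_Rr flipped flip: Rr13_def Rl23_def)
  \<comment> \<open>Here \<open>Rl\<close> exchanges \<open>\<Delta>l\<close> with the flip of
    \<open>\<Delta>r\<close> on the second leg of another copy of \<open>Rl\<close>.\<close>
  have "mul3 s1 s1 s0 lact (*) (*) Rl23 (split_right s1 s1 s0 \<Delta>l Rl) =
      split_right s1 s1 s0 (\<lambda>x. mul2 s1 s0 (*) (*) Rl (\<Delta>l x)) Rl"
    unfolding Rl23_def
    by (rule mul3_leg23_split_right[OF R_in(1,1) linear_comults(2) comults_in(2)])
      (simp_all add: bil unit_act)
  also have "\<dots> = mul3 s1 s1 s0 ract (*) (*)
      (split_right s1 s1 s0 (\<lambda>x. swap2 s1 s0 (\<Delta>r x)) Rl) Rl23"
    unfolding Rl_comult Rl23_def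
    by (rule mul3_split_right_leg23[symmetric, OF R_in(1)]) (simp_all add: bil unit_act)
  finally have 3: "mul3 s1 s1 s0 lact (*) (*) Rl23 (mul3 s1 s1 s0 ract lact (*) Rl13 Rr12) =
      mul3 s1 s1 s0 ract (*) (*) (mul3 s1 s1 s0 lact ract (*) Rr12 Rl13) Rl23"
    by (simp add: split_l_Rl flipped flip: Rl13_def Rr12_def)
  \<comment> \<open>The same exchange on the first leg of \<open>Rr\<close>, again read from right
    to left.\<close>
  have "mul3 s1 s0 s1 (*) (*) lact Rl12 (split_left s1 s0 s1 \<Delta>l Rr) =
      split_left s1 s0 s1 (\<lambda>x. mul2 s1 s0 (*) (*) Rl (\<Delta>l x)) Rr"
    unfolding Rl12_def
    by (rule mul3_leg12_split_left[OF R_in(1,2) linear_comults(2) comults_in(2)])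
      (simp_all add: bil unit_act)
  also have "\<dots> = mul3 s1 s0 s1 (*) (*) ract
      (split_left s1 s0 s1 (\<lambda>x. swap2 s1 s0 (\<Delta>r x)) Rr) Rl12"
    unfolding Rl_comult Rl12_def
    by (rule mul3_split_left_leg12[symmetric, OF R_in(1)]) (simp_all add: bil unit_act)
  finally have 4: "mul3 s1 s0 s1 (*) (*) ract (mul3 s1 s0 s1 lact (*) ract Rr23 Rl13) Rl12 =
      mul3 s1 s0 s1 (*) (*) lact Rl12 (mul3 s1 s0 s1 ract (*) lact Rl13 Rr23)"
    by (simp add: split_l_Rr flipped flip: Rl13_def Rr23_def)
  from 1 2 3 4 show ?thesis by blast
qed

end
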